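(* Consider the problem $$(P)\qquad \min_{x_1,\dots,x_N}\ \sum_{i=1}^N f_i(x_i)\quad\text{subject to}\quad \sum_{i=1}^N g_i(x_i)\le 0,\qquad x_i\in X_i,\ i=1,\dots,N,$$ where for every $i$ the set $X_i\subset\mathbb{R}^{n_i}$ is non-empty, convex and compact, $f_i:\mathbb{R}^{n_i}\to\mathbb{R}$ is convex and each component of $g_i:\mathbb{R}^{n_i}\to\mathbb{R}^S$ is convex, and assume there exist $\bar x_i\in X_i$ with $\sum_{i=1}^N g_i(\bar x_i)<0$. Let $f^\star$ be the optimal cost of (P), let $\mu^\star$ be an optimal Lagrange multiplier of (P) associated with $\sum_{i=1}^N g_i(x_i)\le0$, and let $M>\|\mu^\star\|_1$. Let the edges of a connected undirected graph $\mathcal{G}_u$ be randomly activated according to the model in the context, and let $\{z^t\}$, $\{y^t\}$, $\{(x_i^t,\rho_i^t)\}$ be the sequences generated by the DPD-TV algorithm in the form given in the context, with $\sum_{i=1}^N y_i^0=0$ and constant step-size $\alpha^t=\alpha>0$ for all $t\ge0$. Let $z^\star$ be an optimal solution of $\min_z\tilde p(z)$ and let $f_{\mathrm{best}}^t=\min_{\tau\le t}\sum_{i=1}^N\mathbb{E}[f_i(x_i^\tau)+M\rho_i^\tau]$. Then, for all $t\ge0$, $$f_{\mathrm{best}}^t-f^\star\ \le\ \frac{\|z^0-z^\star\|_W^2}{2\alpha(t+1)}+\frac{C\alpha}{2},$$ with the norm $\|\cdot\|_W$ and the constant $C$ defined in the context.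
   Context: Vector inequalities are componentwise; $\mathbf 1$ is the vector of ones. Random communication model. $\mathcal{G}_u=(\{1,\dots,N\},\mathcal{E}_u)$ is an undirected connected graph with $(i,j)\in\mathcal{E}_u$ iff $(j,i)\in\mathcal{E}_u$; $\mathcal{N}_{i,u}=\{j:(i,j)\in\mathcal{E}_u\}$. Each undirected edge ($i<j$) has activation probability $\sigma_{ij}=\sigma_{ji}\in(0,1]$, and $\nu_{ij}^t$ is the Bernoulli variable with mean $\sigma_{ij}$ equal to $1$ iff the edge is active at time $t$. For each edge $\{\nu_{ij}^t\}_{t\ge0}$ are i.i.d.; for each $t$ the variables $\{\nu_{ij}^t\}_{(i,j)\in\mathcal{E}_u,\,j>i}$ are mutually independent; the edges drawn at time $t$ are independent of those drawn at previous times. $\mathcal{E}^t\subseteq\mathcal{E}_u$ is the set of active edges (containing both orientations of each active edge). Local problems. For $y_i\in\mathbb{R}^S$, $$p_i(y_i)=\min_{x_i,\rho_i}\{f_i(x_i)+M\rho_i:\ g_i(x_i)\le y_i+\rho_i\mathbf 1,\ \rho_i\ge0,\ x_i\in X_i\}.$$ Edge variables. $z\in\mathbb{R}^{S|\mathcal{E}_u|}$ stacks vectors $z_{(ij)}\in\mathbb{R}^S$, one for each ordered pair $(i,j)\in\mathcal{E}_u$. The linear map $\Pi$ is $[\Pi z]_i=\sum_{j\in\mathcal{N}_{i,u}}(z_{(ij)}-z_{(ji)})$, and $\tilde p(z)=\sum_{i=1}^N p_i([\Pi z]_i)$. Algorithm. $z^0$ is (deterministic and) such that $\Pi z^0=y^0$.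 For $t\ge0$, $y_i^t=[\Pi z^t]_i$; $(x_i^t,\rho_i^t)$ is an optimal solution of the problem defining $p_i(y_i^t)$ and $\mu_i^t$ is an optimal Lagrange multiplier of that problem for the constraint $g_i(x_i)\le y_i^t+\rho_i\mathbf 1$ (a fixed selection depending only on $y_i^t$); then $z_{(ij)}^{t+1}=z_{(ij)}^t+\alpha^t(\mu_i^t-\mu_j^t)$ if $(i,j)\in\mathcal{E}^t$ and $z_{(ij)}^{t+1}=z_{(ij)}^t$ otherwise. Equivalently $y_i^{t+1}=y_i^t+2\alpha^t\sum_{j:(i,j)\in\mathcal{E}^t}(\mu_i^t-\mu_j^t)$. Blocks and constants. Blocks $\ell=1,\dots,B$, $B=|\mathcal{E}_u|/2$, correspond to undirected edges $(i,j)$, $i<j$, with $z_\ell=(z_{(ij)},z_{(ji)})\in\mathbb{R}^{2S}$ and $\sigma_\ell=\sigma_{ij}$. $\|z\|_W^2=\sum_{\ell=1}^B\|z_\ell\|^2/\sigma_\ell$. $C_\ell>0$ are constants such that the $\ell$-th block of every subgradient of $\tilde p$ at every $z$ has Euclidean norm at most $C_\ell$, and $C=\sum_{\ell=1}^B C_\ell^2/\sigma_\ell$. *)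

theory Defs
  imports "HOL-Probability.Probability"
begin

section \<open>Constrained programs and their Lagrangian duals\<close>

text \<open>
  The program is: minimize \<open>F x\<close> subject to \<open>G x \<le> 0\<close> and \<open>x \<in> D\<close>.
  Only the constraint \<open>G x \<le> 0\<close> is dualized.  The order on \<open>real ^ 's\<close> is componentwise.
\<close>

definition feasible_set :: "'b set \<Rightarrow> ('b \<Rightarrow> real ^ 's) \<Rightarrow> 'b set" where
  "feasible_set D G = {x \<in> D. G x \<le> 0}"

definition optimal_cost :: "('b \<Rightarrow> real) \<Rightarrow> 'b set \<Rightarrow> ('b \<Rightarrow> real ^ 's) \<Rightarrow> real" where
  "optimal_cost F D G = (INF x \<in> feasible_set D G. F x)"

definition optimal_solution :: "('b \<Rightarrow> real) \<Rightarrow> 'b set \<Rightarrow> ('b \<Rightarrow> real ^ 's) \<Rightarrow> 'b \<Rightarrow> bool" where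
  "optimal_solution F D G x \<longleftrightarrow>
     x \<in> feasible_set D G \<and> (\<forall>x' \<in> feasible_set D G. F x \<le> F x')"

text \<open>The dual function is extended-real valued since \<open>D\<close> may be unbounded.\<close>

definition dual_function ::
    "('b \<Rightarrow> real) \<Rightarrow> 'b set \<Rightarrow> ('b \<Rightarrow> real ^ 's) \<Rightarrow> real ^ 's \<Rightarrow> ereal" where
  "dual_function F D G \<mu> = (INF x \<in> D. ereal (F x + \<mu> \<bullet> G x))"

text \<open>
  An optimal Lagrange multiplier is an optimal solution of the dual problem.  That its dual value
  equals the optimal cost (strong duality) is not part of the definition.
\<close>

definition optimal_multiplier ::
    "('b \<Rightarrow> real) \<Rightarrow> 'b set \<Rightarrow> ('b \<Rightarrow> real ^ 's) \<Rightarrow> real ^ 's \<Rightarrow> bool" where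
  "optimal_multiplier F D G \<mu> \<longleftrightarrow>
     0 \<le> \<mu> \<and> (\<forall>\<mu>'. 0 \<le> \<mu>' \<longrightarrow> dual_function F D G \<mu>' \<le> dual_function F D G \<mu>)"


section \<open>The coupled problem and the local problems\<close>

text \<open>
  Agents are \<open>1, \<dots>, N\<close>; the decision variable of the coupled problem is the tuple
  \<open>x = (x 1, \<dots>, x N)\<close>, and values of \<open>x\<close> outside \<open>{1..N}\<close> are ignored.
\<close>

definition coupled_cost :: "nat \<Rightarrow> (nat \<Rightarrow> 'a \<Rightarrow> real) \<Rightarrow> (nat \<Rightarrow> 'a) \<Rightarrow> real" where
  "coupled_cost N f x = (\<Sum>i = 1..N. f i (x i))"

definition coupling_constraint ::
    "nat \<Rightarrow> (nat \<Rightarrow> 'a \<Rightarrow> real ^ 's) \<Rightarrow> (nat \<Rightarrow> 'a) \<Rightarrow> real ^ 's" where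
  "coupling_constraint N g x = (\<Sum>i = 1..N. g i (x i))"

definition coupled_domain :: "nat \<Rightarrow> (nat \<Rightarrow> 'a set) \<Rightarrow> (nat \<Rightarrow> 'a) set" where
  "coupled_domain N X = {x. \<forall>i \<in> {1..N}. x i \<in> X i}"

text \<open>
  Local problem of one agent with allocation \<open>y\<close>, in the pair \<open>(x, \<rho>)\<close>; note that \<open>vec \<rho>\<close> is
  the vector all of whose entries are \<open>\<rho>\<close>.
\<close>

definition local_cost :: "('a \<Rightarrow> real) \<Rightarrow> real \<Rightarrow> 'a \<times> real \<Rightarrow> real" where
  "local_cost f M = (\<lambda>(x, \<rho>). f x + M * \<rho>)"

definition local_domain :: "'a set \<Rightarrow> ('a \<times> real) set" where
  "local_domain X = X \<times> {0..}"

definition local_constraint ::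
    "('a \<Rightarrow> real ^ 's) \<Rightarrow> real ^ 's \<Rightarrow> 'a \<times> real \<Rightarrow> real ^ 's" where
  "local_constraint g y = (\<lambda>(x, \<rho>). g x - (y + vec \<rho>))"

definition local_value ::
    "('a \<Rightarrow> real) \<Rightarrow> ('a \<Rightarrow> real ^ 's) \<Rightarrow> 'a set \<Rightarrow> real \<Rightarrow> real ^ 's \<Rightarrow> real" where
  "local_value f g X M y = optimal_cost (local_cost f M) (local_domain X) (local_constraint g y)"


section \<open>Graph and edge variables\<close>

definition connected_graph :: "nat \<Rightarrow> (nat \<times> nat) set \<Rightarrow> bool" where
  "connected_graph N E \<longleftrightarrow>
     E \<subseteq> {1..N} \<times> {1..N} \<and> irrefl E \<and> sym E \<and> (\<forall>i \<in> {1..N}. \<forall>j \<in> {1..N}. (i, j) \<in> E\<^sup>*)"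

text \<open>
  An edge variable is a function \<open>z\<close> on ordered pairs.  Everything below depends only on the
  restriction of \<open>z\<close> to \<open>E\<close>.
\<close>

definition edge_map ::
    "(nat \<times> nat) set \<Rightarrow> (nat \<times> nat \<Rightarrow> real ^ 's) \<Rightarrow> nat \<Rightarrow> real ^ 's" where
  "edge_map E z i = (\<Sum>j \<in> {j. (i, j) \<in> E}. z (i, j) - z (j, i))"

definition edge_objective ::
    "nat \<Rightarrow> (nat \<times> nat) set \<Rightarrow> (nat \<Rightarrow> 'a \<Rightarrow> real) \<Rightarrow> (nat \<Rightarrow> 'a \<Rightarrow> real ^ 's) \<Rightarrow> (nat \<Rightarrow> 'a set)
      \<Rightarrow> real \<Rightarrow> (nat \<times> nat \<Rightarrow> real ^ 's) \<Rightarrow> real" where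
  "edge_objective N E f g X M z = (\<Sum>i = 1..N. local_value (f i) (g i) (X i) M (edge_map E z i))"

definition edge_subgradient ::
    "(nat \<times> nat) set \<Rightarrow> ((nat \<times> nat \<Rightarrow> real ^ 's) \<Rightarrow> real)
      \<Rightarrow> (nat \<times> nat \<Rightarrow> real ^ 's) \<Rightarrow> (nat \<times> nat \<Rightarrow> real ^ 's) \<Rightarrow> bool" where
  "edge_subgradient E h z d \<longleftrightarrow> (\<forall>w. h z + (\<Sum>e \<in> E. d e \<bullet> (w e - z e)) \<le> h w)"

definition blocks :: "(nat \<times> nat) set \<Rightarrow> (nat \<times> nat) set" where
  "blocks E = {(i, j) \<in> E. i < j}"

text \<open>The norm of the product type is the Euclidean norm of the stacked pair.\<close>

definition block :: "(nat \<times> nat \<Rightarrow> real ^ 's) \<Rightarrow> nat \<times> nat \<Rightarrow> (real ^ 's) \<times> (real ^ 's)" where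
  "block z = (\<lambda>(i, j). (z (i, j), z (j, i)))"

definition weighted_norm_sq ::
    "(nat \<times> nat) set \<Rightarrow> (nat \<times> nat \<Rightarrow> real) \<Rightarrow> (nat \<times> nat \<Rightarrow> real ^ 's) \<Rightarrow> real" where
  "weighted_norm_sq E \<sigma> z = (\<Sum>l \<in> blocks E. (norm (block z l))\<^sup>2 / \<sigma> l)"

definition block_bounds ::
    "(nat \<times> nat) set \<Rightarrow> ((nat \<times> nat \<Rightarrow> real ^ 's) \<Rightarrow> real) \<Rightarrow> (nat \<times> nat \<Rightarrow> real) \<Rightarrow> bool" where
  "block_bounds E h c \<longleftrightarrow>
     (\<forall>l \<in> blocks E. 0 < c l \<and> (\<forall>z d. edge_subgradient E h z d \<longrightarrow> norm (block d l) \<le> c l))"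


section \<open>Random activation of edges\<close>

text \<open>
  \<open>\<nu> t (i, j)\<close>, for \<open>i < j\<close>, is the Bernoulli variable telling whether the undirected edge between
  \<open>i\<close> and \<open>j\<close> is active at time \<open>t\<close>.  The last three conjuncts are independence over time for each
  edge, independence over edges at each time, and independence of the draw at time \<open>t\<close> from
  all earlier draws.
\<close>

definition random_activation ::
    "'w measure \<Rightarrow> (nat \<times> nat) set \<Rightarrow> (nat \<times> nat \<Rightarrow> real) \<Rightarrow> (nat \<Rightarrow> nat \<times> nat \<Rightarrow> 'w \<Rightarrow> bool)
      \<Rightarrow> bool" where
  "random_activation P E \<sigma> \<nu> \<longleftrightarrow>
     prob_space P \<and>
     (\<forall>(i, j) \<in> E. 0 < \<sigma> (i, j) \<and> \<sigma> (i, j) \<le> 1 \<and> \<sigma> (i, j) = \<sigma> (j, i)) \<and>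
     (\<forall>t. \<forall>l \<in> blocks E.
        \<nu> t l \<in> measurable P (count_space UNIV) \<and>
        distr P (count_space UNIV) (\<nu> t l) = measure_pmf (bernoulli_pmf (\<sigma> l))) \<and>
     (\<forall>l \<in> blocks E. prob_space.indep_vars P (\<lambda>_. count_space UNIV) (\<lambda>t. \<nu> t l) UNIV) \<and>
     (\<forall>t. prob_space.indep_vars P (\<lambda>_. count_space UNIV) (\<nu> t) (blocks E)) \<and>
     (\<forall>t. prob_space.indep_var P
        (Pi\<^sub>M ({t} \<times> blocks E) (\<lambda>_. count_space UNIV))
        (\<lambda>\<omega>. \<lambda>(s, l) \<in> {t} \<times> blocks E. \<nu> s l \<omega>)
        (Pi\<^sub>M ({..<t} \<times> blocks E) (\<lambda>_. count_space UNIV))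
        (\<lambda>\<omega>. \<lambda>(s, l) \<in> {..<t} \<times> blocks E. \<nu> s l \<omega>))"

definition active_edges ::
    "(nat \<times> nat) set \<Rightarrow> (nat \<Rightarrow> nat \<times> nat \<Rightarrow> 'w \<Rightarrow> bool) \<Rightarrow> nat \<Rightarrow> 'w \<Rightarrow> (nat \<times> nat) set" where
  "active_edges E \<nu> t \<omega> = {(i, j) \<in> E. \<nu> t (min i j, max i j) \<omega>}"


section \<open>The algorithm\<close>

text \<open>
  \<open>z t \<omega>\<close>, \<open>y t \<omega> i\<close>, \<open>x t \<omega> i\<close>, \<open>\<rho> t \<omega> i\<close>, \<open>\<mu> t \<omega> i\<close> are the iterates along the sample \<open>\<omega>\<close>.
  The multipliers come from a fixed selection \<open>m\<close>, so that \<open>\<mu> t \<omega> i\<close> is a function of \<open>y t \<omega> i\<close>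
  alone; the pair \<open>(x t \<omega> i, \<rho> t \<omega> i)\<close> may be any optimal solution of the local problem.
\<close>

definition dpd_tv ::
    "'w set \<Rightarrow> nat \<Rightarrow> (nat \<times> nat) set \<Rightarrow> (nat \<Rightarrow> 'a \<Rightarrow> real) \<Rightarrow> (nat \<Rightarrow> 'a \<Rightarrow> real ^ 's)
      \<Rightarrow> (nat \<Rightarrow> 'a set) \<Rightarrow> real \<Rightarrow> (nat \<Rightarrow> real) \<Rightarrow> (nat \<Rightarrow> nat \<times> nat \<Rightarrow> 'w \<Rightarrow> bool)
      \<Rightarrow> (nat \<times> nat \<Rightarrow> real ^ 's)
      \<Rightarrow> (nat \<Rightarrow> 'w \<Rightarrow> nat \<times> nat \<Rightarrow> real ^ 's) \<Rightarrow> (nat \<Rightarrow> 'w \<Rightarrow> nat \<Rightarrow> real ^ 's)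
      \<Rightarrow> (nat \<Rightarrow> 'w \<Rightarrow> nat \<Rightarrow> 'a) \<Rightarrow> (nat \<Rightarrow> 'w \<Rightarrow> nat \<Rightarrow> real) \<Rightarrow> (nat \<Rightarrow> 'w \<Rightarrow> nat \<Rightarrow> real ^ 's)
      \<Rightarrow> bool" where
  "dpd_tv \<Omega> N E f g X M step \<nu> z0 z y x \<rho> \<mu> \<longleftrightarrow>
     (\<exists>m.
       (\<forall>i \<in> {1..N}. \<forall>v. optimal_multiplier
          (local_cost (f i) M) (local_domain (X i)) (local_constraint (g i) v) (m i v)) \<and>
       (\<forall>\<omega> \<in> \<Omega>.
         (\<forall>e \<in> E. z 0 \<omega> e = z0 e) \<and>
         (\<forall>t. \<forall>i \<in> {1..N}.
            y t \<omega> i = edge_map E (z t \<omega>) i \<and>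
            optimal_solution
              (local_cost (f i) M) (local_domain (X i)) (local_constraint (g i) (y t \<omega> i))
              (x t \<omega> i, \<rho> t \<omega> i) \<and>
            \<mu> t \<omega> i = m i (y t \<omega> i)) \<and>
         (\<forall>t. \<forall>(i, j) \<in> E.
            z (Suc t) \<omega> (i, j) =
              (if (i, j) \<in> active_edges E \<nu> t \<omega>
               then z t \<omega> (i, j) + step t *\<^sub>R (\<mu> t \<omega> i - \<mu> t \<omega> j)
               else z t \<omega> (i, j)))))"

definition best_cost ::
    "'w measure \<Rightarrow> nat \<Rightarrow> (nat \<Rightarrow> 'a \<Rightarrow> real) \<Rightarrow> real
      \<Rightarrow> (nat \<Rightarrow> 'w \<Rightarrow> nat \<Rightarrow> 'a) \<Rightarrow> (nat \<Rightarrow> 'w \<Rightarrow> nat \<Rightarrow> real) \<Rightarrow> nat \<Rightarrow> real" where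
  "best_cost P N f M x \<rho> t =
     Min ((\<lambda>s. \<Sum>i = 1..N. LINT \<omega>|P. f i (x s \<omega> i) + M * \<rho> s \<omega> i) ` {..t})"

end

theory Submission
  imports Defs
begin

text \<open>
  By strong duality (Slater holds for the local problem, as \<open>\<rho>\<close> may be taken large) the negative
  multiplier is a subgradient of each local value function, so the vector with entries
  \<open>\<mu> j - \<mu> i\<close> is a subgradient of the edge objective and the algorithm is a randomized block
  subgradient method.  Weighting block \<open>l\<close> by \<open>1 / \<sigma> l\<close> compensates for its activation
  probability, so that the expected squared distance to \<open>zstar\<close> obeys the usual subgradient
  descent inequality.  The minimum of the edge objective is at most \<open>fstar\<close>, because by
  connectivity every allocation summing to zero is the image of some edge variable.
\<close>

section \<open>Duality for the local problems\<close>

text \<open>Separation of the origin from the convex set \<open>A\<close> of pairs that dominate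
  \<open>(G x, F x - p)\<close>. Since \<open>A\<close> is closed under increasing either entry, the
  normal \<open>(\<eta>, \<beta>)\<close> is nonnegative; the Slater point \<open>xb\<close> rules
  out a vertical hyperplane, so that \<open>\<beta>\<close> is positive and \<eta> divided by
  \<beta> is the multiplier.\<close>

lemma convex_multiplier_exists:
  fixes F :: "'b::real_vector \<Rightarrow> real" and G :: "'b \<Rightarrow> real ^ 's"
  assumes F: "convex_on D F" and G: "\<And>k. convex_on D (\<lambda>x. G x $ k)"
    and xb: "xb \<in> D" "\<And>k. G xb $ k < 0"
    and p: "\<And>x. x \<in> feasible_set D G \<Longrightarrow> p \<le> F x"
  obtains \<mu> where "0 \<le> \<mu>" "\<And>x. x \<in> D \<Longrightarrow> p \<le> F x + \<mu> \<bullet> G x"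
proof -
  have D: "convex D"
    using F by (simp add: convex_on_def)
  \<comment> \<open>The strict inequality for the cost keeps the origin out of \<open>A\<close>:
    otherwise some feasible point would cost less than \<open>p\<close>.\<close>
  define A where "A = {(u, r) | u r. \<exists>x\<in>D. (\<forall>k. G x $ k \<le> u $ k) \<and> F x < r + p}"
  have "convex A"
  proof (rule convexI)
    fix a b :: "(real ^ 's) \<times> real" and s t :: real
    assume a: "a \<in> A" and b: "b \<in> A" and st: "0 \<le> s" "0 \<le> t" "s + t = 1"
    obtain x where x: "x \<in> D" "\<And>k. G x $ k \<le> fst a $ k" "F x < snd a + p"
      using a by (auto simp: A_def)
    obtain y where y: "y \<in> D" "\<And>k. G y $ k \<le> fst b $ k" "F y < snd b + p"
      using b by (auto simp: A_def)
    let ?w = "s *\<^sub>R x + t *\<^sub>R y"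
    have w: "?w \<in> D"
      using D x y st by (simp add: convexD)
    have "G ?w $ k \<le> s * fst a $ k + t * fst b $ k" for k
    proof -
      have "G ?w $ k \<le> s * G x $ k + t * G y $ k"
        using G[of k] x y st by (simp add: convex_on_def)
      also have "\<dots> \<le> s * fst a $ k + t * fst b $ k"
        using x y st by (intro add_mono mult_left_mono) auto
      finally show ?thesis .
    qed
    moreover have "F ?w < s * snd a + t * snd b + p"
    proof -
      have "F ?w \<le> s * F x + t * F y"
        using F x y st by (simp add: convex_on_def)
      also have "\<dots> < s * (snd a + p) + t * (snd b + p)"
      \<comment> \<open>Strictness comes from \<open>x\<close> when \<open>s\<close> is positive and
        from \<open>y\<close> when \<open>s\<close> vanishes.\<close>
      proof (cases "s = 0")
        case True
        then show ?thesis using st y by simp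
      next
        case False
        then show ?thesis
          using st x y by (intro add_less_le_mono mult_strict_left_mono mult_left_mono) auto
      qed
      also have "\<dots> = s * snd a + t * snd b + (s + t) * p"
        by (simp add: algebra_simps)
      finally show ?thesis using st by simp
    qed
    ultimately have "(fst (s *\<^sub>R a + t *\<^sub>R b), snd (s *\<^sub>R a + t *\<^sub>R b)) \<in> A"
      unfolding A_def using w by (auto intro!: bexI[of _ ?w])
    then show "s *\<^sub>R a + t *\<^sub>R b \<in> A" by (simp only: prod.collapse)
  qed
  moreover have "0 \<notin> A"
  proof
    assume "0 \<in> A"
    then obtain x where "x \<in> D" "\<And>k. G x $ k \<le> 0" "F x < p"
      by (auto simp: A_def zero_prod_def)
    with p[of x] show False
      by (auto simp: feasible_set_def less_eq_vec_def)
  qed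
  ultimately have "\<exists>c. c \<noteq> 0 \<and> (\<forall>q\<in>A. 0 \<le> c \<bullet> q)"
    by (rule separating_hyperplane_set_0)
  then obtain c where c: "c \<noteq> 0" "\<And>q. q \<in> A \<Longrightarrow> 0 \<le> c \<bullet> q"
    by (elim exE conjE) simp
  define \<eta> \<beta> where "\<eta> = fst c" and "\<beta> = snd c"
  have sep: "0 \<le> \<eta> \<bullet> u + \<beta> * r"
    if "x \<in> D" "\<And>k. G x $ k \<le> u $ k" "F x < r + p" for x u r
  proof -
    have "(u, r) \<in> A" using that by (auto simp: A_def)
    from c(2)[OF this] show ?thesis
      by (simp add: \<eta>_def \<beta>_def inner_prod_def)
  qed
  \<comment> \<open>An affine function of \<open>n\<close> that never becomes negative has
    nonnegative slope. It is applied along rays in \<open>A\<close> that start above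
    \<open>xb\<close>; the summand 1 in the cost entry supplies the strict inequality.\<close>
  have unbounded: "0 \<le> b" if "\<And>n::nat. 0 \<le> a + real n * b" for a b :: real
  proof (rule ccontr)
    assume "\<not> 0 \<le> b"
    then obtain n where "a < real n * (- b)"
      using reals_Archimedean3[of "- b"] by auto
    with that[of n] show False by simp
  qed
  have \<eta>: "0 \<le> \<eta> $ k" for k
  proof (rule unbounded)
    fix n :: nat
    have "0 \<le> \<eta> \<bullet> (G xb + axis k (real n)) + \<beta> * (F xb - p + 1)"
      by (rule sep[OF xb(1)]) (auto simp: axis_def)
    then show "0 \<le> (\<eta> \<bullet> G xb + \<beta> * (F xb - p + 1)) + real n * \<eta> $ k"
      by (simp add: inner_add_right inner_axis algebra_simps)
  qed
  have \<beta>: "0 \<le> \<beta>"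
  proof (rule unbounded)
    fix n :: nat
    have "0 \<le> \<eta> \<bullet> G xb + \<beta> * (F xb - p + 1 + real n)"
      by (rule sep[OF xb(1)]) auto
    then show "0 \<le> (\<eta> \<bullet> G xb + \<beta> * (F xb - p + 1)) + real n * \<beta>"
      by (simp add: algebra_simps)
  qed
  \<comment> \<open>If \<beta> vanished, \<open>\<eta> \<bullet> G xb\<close> would be both
    nonnegative and a sum of nonpositive terms. As every component of \<open>G xb\<close> is
    negative, \<eta> would vanish too, contradicting \<open>c \<noteq> 0\<close>.\<close>
  have "\<beta> \<noteq> 0"
  proof
    assume "\<beta> = 0"
    have "0 \<le> \<eta> \<bullet> G xb"
      using sep[OF xb(1), of "G xb" "F xb - p + 1"] \<open>\<beta> = 0\<close> by simp
    moreover have "\<eta> \<bullet> G xb = (\<Sum>k\<in>UNIV. \<eta> $ k * G xb $ k)"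
      by (simp add: inner_vec_def)
    moreover have nonpos: "\<eta> $ k * G xb $ k \<le> 0" for k
      using \<eta>[of k] xb(2)[of k] by (simp add: mult_nonneg_nonpos)
    ultimately have "(\<Sum>k\<in>UNIV. \<eta> $ k * G xb $ k) = 0"
      by (metis antisym sum_nonpos)
    then have "\<eta> $ k * G xb $ k = 0" for k
      using nonpos sum_nonneg_eq_0_iff[of UNIV "\<lambda>k. - (\<eta> $ k * G xb $ k)"]
      by (simp add: sum_negf)
    then have "\<eta> = 0"
      using xb(2) by (auto simp: vec_eq_iff less_le)
    with \<open>\<beta> = 0\<close> c(1) show False
      by (simp add: \<eta>_def \<beta>_def prod_eq_iff)
  qed
  with \<beta> have \<beta>: "0 < \<beta>" by simp
  show thesis
  proof (rule that)
    show "0 \<le> (1 / \<beta>) *\<^sub>R \<eta>"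
      using \<eta> \<beta> by (simp add: less_eq_vec_def)
    fix x assume x: "x \<in> D"
    show "p \<le> F x + ((1 / \<beta>) *\<^sub>R \<eta>) \<bullet> G x"
    \<comment> \<open>The pair \<open>(G x, F x - p)\<close> itself misses the strict inequality in
      \<open>A\<close>, so its cost entry is raised by an arbitrary positive
      \<open>e\<close>.\<close>
    proof (rule field_le_epsilon)
      fix e :: real assume "0 < e"
      then have "0 \<le> \<eta> \<bullet> G x + \<beta> * (F x - p + e)"
        by (intro sep[OF x]) auto
      then have "0 \<le> (\<eta> \<bullet> G x + \<beta> * (F x - p + e)) / \<beta>"
        using \<beta> by simp
      also have "\<dots> = (\<eta> \<bullet> G x) / \<beta> + (F x - p + e)"
        using \<beta> by (simp add: add_divide_distrib)
      finally show "p \<le> F x + ((1 / \<beta>) *\<^sub>R \<eta>) \<bullet> G x + e"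
        by simp
    qed
  qed
qed

text \<open>An optimal multiplier is defined only as a dual maximizer. Its dual value is at least
  that of the multiplier obtained by separation, hence at least \<open>p\<close>; this is the part
  of strong duality used below.\<close>

lemma optimal_multiplier_lagrangian_bound:
  fixes F :: "'b::real_vector \<Rightarrow> real" and G :: "'b \<Rightarrow> real ^ 's"
  assumes "convex_on D F" "\<And>k. convex_on D (\<lambda>x. G x $ k)"
    and "xb \<in> D" "\<And>k. G xb $ k < 0"
    and "\<And>x. x \<in> feasible_set D G \<Longrightarrow> p \<le> F x"
    and m: "optimal_multiplier F D G m" and x: "x \<in> D"
  shows "p \<le> F x + m \<bullet> G x"
proof -
  obtain \<mu> where \<mu>: "0 \<le> \<mu>" "\<And>x. x \<in> D \<Longrightarrow> p \<le> F x + \<mu> \<bullet> G x"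
    using convex_multiplier_exists[OF assms(1-5)] by blast
  have "ereal p \<le> dual_function F D G \<mu>"
    unfolding dual_function_def by (rule INF_greatest) (simp add: \<mu>)
  also have "\<dots> \<le> dual_function F D G m"
    using m \<mu>(1) by (simp add: optimal_multiplier_def)
  also have "\<dots> \<le> ereal (F x + m \<bullet> G x)"
    unfolding dual_function_def by (rule INF_lower[OF x])
  finally show ?thesis by simp
qed

section \<open>Local problems as functions of the allocation\<close>

lemma local_constraint_nth: "local_constraint g v a $ k = g (fst a) $ k - v $ k - snd a"
  by (simp add: local_constraint_def split_beta)

text \<open>The relaxation variable makes every allocation strictly feasible:
  \<open>1 + norm (g x - v)\<close> exceeds each component of \<open>g x - v\<close>.\<close>

lemma local_problem_slater:
  fixes g :: "'a \<Rightarrow> real ^ 's"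
  assumes "x \<in> X"
  obtains a where "a \<in> local_domain X" "\<And>k. local_constraint g v a $ k < 0"
proof (rule that)
  let ?a = "(x, 1 + norm (g x - v))"
  show "?a \<in> local_domain X"
    using assms by (simp add: local_domain_def)
  show "local_constraint g v ?a $ k < 0" for k
    using component_le_norm_cart[of "g x - v" k] by (simp add: local_constraint_nth)
qed

text \<open>
  Boundedness below of one instance of the local problem propagates to all other right-hand sides
  through a multiplier, so that no continuity or compactness argument is needed for \<open>local_value\<close>
  to be a genuine infimum everywhere.
\<close>

lemma local_cost_lower_bound:
  fixes f :: "'a::real_vector \<Rightarrow> real" and g :: "'a \<Rightarrow> real ^ 's"
  assumes f: "convex_on X f" and g: "\<And>k. convex_on X (\<lambda>x. g x $ k)" and X: "X \<noteq> {}"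
    and p: "\<And>a. a \<in> feasible_set (local_domain X) (local_constraint g v) \<Longrightarrow> p \<le> local_cost f M a"
    and m: "optimal_multiplier (local_cost f M) (local_domain X) (local_constraint g v) m"
    and a: "a \<in> feasible_set (local_domain X) (local_constraint g w)"
  shows "p - m \<bullet> (w - v) \<le> local_cost f M a"
proof -
  have cX: "convex X" using f by (simp add: convex_on_def)
  have D: "convex (local_domain X)"
    unfolding local_domain_def by (intro convex_Times cX convex_real_interval)
  have F: "convex_on (local_domain X) (local_cost f M)"
    unfolding convex_on_def
  proof (intro conjI D ballI allI impI)
    fix a b and s t :: real
    assume ab: "a \<in> local_domain X" "b \<in> local_domain X" and st: "0 \<le> s" "0 \<le> t" "s + t = 1"
    have "f (s *\<^sub>R fst a + t *\<^sub>R fst b) \<le> s * f (fst a) + t * f (fst b)"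
      using f ab st by (auto simp: convex_on_def local_domain_def)
    then show "local_cost f M (s *\<^sub>R a + t *\<^sub>R b) \<le> s * local_cost f M a + t * local_cost f M b"
      by (simp add: local_cost_def split_beta algebra_simps)
  qed
  have G: "convex_on (local_domain X) (\<lambda>a. local_constraint g v a $ k)" for k
    unfolding convex_on_def
  proof (intro conjI D ballI allI impI)
    fix a b and s t :: real
    assume ab: "a \<in> local_domain X" "b \<in> local_domain X" and st: "0 \<le> s" "0 \<le> t" "s + t = 1"
    have "g (s *\<^sub>R fst a + t *\<^sub>R fst b) $ k \<le> s * g (fst a) $ k + t * g (fst b) $ k"
      using g[of k] ab st by (auto simp: convex_on_def local_domain_def)
    moreover have "v $ k = s * v $ k + t * v $ k"
      using st by (metis distrib_right mult_1)
    ultimately show "local_constraint g v (s *\<^sub>R a + t *\<^sub>R b) $ k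
        \<le> s * local_constraint g v a $ k + t * local_constraint g v b $ k"
      by (simp add: local_constraint_nth algebra_simps)
  qed
  obtain x where x: "x \<in> X" using X by auto
  obtain b where b: "b \<in> local_domain X" "\<And>k. local_constraint g v b $ k < 0"
    using local_problem_slater[OF x, of g v] by blast
  \<comment> \<open>The domain does not depend on the allocation, so the Lagrangian bound for
    \<open>v\<close> holds at \<open>a\<close>, which is feasible for \<open>w\<close>. The two
    constraint functions differ by the constant \<open>w - v\<close>, which the multiplier
    prices.\<close>
  have "p \<le> local_cost f M a + m \<bullet> local_constraint g v a"
    using a by (intro optimal_multiplier_lagrangian_bound[OF F G b p m]) (auto simp: feasible_set_def)
  moreover have "m \<bullet> local_constraint g w a \<le> 0"
  proof -
    have "m $ k * local_constraint g w a $ k \<le> 0" for k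
      using m a by (intro mult_nonneg_nonpos)
        (auto simp: optimal_multiplier_def less_eq_vec_def feasible_set_def)
    then show ?thesis by (simp add: inner_vec_def sum_nonpos)
  qed
  moreover have "local_constraint g v a = local_constraint g w a + (w - v)"
    by (simp add: local_constraint_def split_beta)
  ultimately show ?thesis by (simp add: inner_add_right)
qed

text \<open>The solution \<open>a0\<close> bounds the cost from below for the allocation
  \<open>v0\<close>, and its multiplier carries the bound to all others. With the infimum itself as
  the lower bound \<open>p\<close>, the same estimate shows that \<open>- m v\<close> is a
  subgradient at \<open>v\<close>.\<close>

lemma local_value_multiplier:
  fixes f :: "'a::real_vector \<Rightarrow> real" and g :: "'a \<Rightarrow> real ^ 's"
  assumes f: "convex_on X f" and g: "\<And>k. convex_on X (\<lambda>x. g x $ k)" and X: "X \<noteq> {}"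
    and m: "\<And>v. optimal_multiplier (local_cost f M) (local_domain X) (local_constraint g v) (m v)"
    and a0: "optimal_solution (local_cost f M) (local_domain X) (local_constraint g v0) a0"
  shows local_value_lower:
      "\<And>v a. a \<in> feasible_set (local_domain X) (local_constraint g v)
        \<Longrightarrow> local_value f g X M v \<le> local_cost f M a"
    and local_value_subgradient:
      "\<And>v w. local_value f g X M v - m v \<bullet> (w - v) \<le> local_value f g X M w"
proof -
  have bdd: "bdd_below (local_cost f M ` feasible_set (local_domain X) (local_constraint g v))" for v
  proof (rule bdd_belowI2)
    fix a assume a: "a \<in> feasible_set (local_domain X) (local_constraint g v)"
    show "local_cost f M a0 - m v0 \<bullet> (v - v0) \<le> local_cost f M a"
      by (rule local_cost_lower_bound[OF f g X _ m a])
        (use a0 in \<open>auto simp: optimal_solution_def\<close>)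
  qed
  show lower: "local_value f g X M v \<le> local_cost f M a"
    if "a \<in> feasible_set (local_domain X) (local_constraint g v)" for v a
    unfolding local_value_def optimal_cost_def by (rule cINF_lower[OF bdd that])
  show "local_value f g X M v - m v \<bullet> (w - v) \<le> local_value f g X M w" for v w
  proof -
    \<comment> \<open>A Slater point for \<open>w\<close> shows that the infimum at \<open>w\<close>
      is over a nonempty set.\<close>
    obtain x where x: "x \<in> X" using X by auto
    obtain b where "b \<in> local_domain X" "\<And>k. local_constraint g w b $ k < 0"
      using local_problem_slater[OF x, of g w] by blast
    then have "b \<in> feasible_set (local_domain X) (local_constraint g w)"
      by (auto simp: feasible_set_def less_eq_vec_def less_imp_le)
    then show ?thesis
      unfolding local_value_def[of f g X M w] optimal_cost_def
      by (intro cINF_greatest local_cost_lower_bound[OF f g X lower m]) auto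
  qed
qed

lemma local_value_eq_optimal_solution:
  assumes "optimal_solution (local_cost f M) (local_domain X) (local_constraint g v) a"
  shows "local_value f g X M v = local_cost f M a"
  unfolding local_value_def optimal_cost_def
  using assms by (intro cInf_eq_minimum) (auto simp: optimal_solution_def)


section \<open>Edge variables\<close>

lemma finite_connected_graph: "connected_graph N E \<Longrightarrow> finite E"
  unfolding connected_graph_def by (meson finite_SigmaI finite_atLeastAtMost finite_subset)

lemma finite_blocks: "connected_graph N E \<Longrightarrow> finite (blocks E)"
  by (rule finite_subset[OF _ finite_connected_graph]) (auto simp: blocks_def)

lemma finite_neighbours: "finite E \<Longrightarrow> finite {j. (i, j) \<in> E}"
  using finite_vimageI[of E "Pair i"] by (simp add: vimage_def inj_on_def)

text \<open>Without loops, each edge has exactly one orientation in \<open>blocks E\<close>, and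
  swapping yields the other.\<close>

lemma sum_edges_eq_sum_blocks:
  fixes h :: "nat \<times> nat \<Rightarrow> 'b::comm_monoid_add"
  assumes "connected_graph N E"
  shows "(\<Sum>e\<in>E. h e) = (\<Sum>(i, j)\<in>blocks E. h (i, j) + h (j, i))"
proof -
  have E: "sym E" "irrefl E"
    using assms by (auto simp: connected_graph_def)
  have split: "E = blocks E \<union> prod.swap ` blocks E"
  proof (intro equalityI subsetI)
    fix e assume e: "e \<in> E"
    obtain i j where ij: "e = (i, j)" by (cases e)
    have "(j, i) \<in> E" "i \<noteq> j"
      using E e ij by (auto simp: sym_def irrefl_def)
    then have "e \<in> blocks E \<or> (j, i) \<in> blocks E"
      using e ij by (auto simp: blocks_def)
    moreover have "e = prod.swap (j, i)" by (simp add: ij)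
    ultimately show "e \<in> blocks E \<union> prod.swap ` blocks E" by blast
  next
    fix e assume "e \<in> blocks E \<union> prod.swap ` blocks E"
    then show "e \<in> E" using E(1) by (auto simp: blocks_def sym_def)
  qed
  have disj: "blocks E \<inter> prod.swap ` blocks E = {}"
    by (auto simp: blocks_def)
  have finb: "finite (blocks E)" by (rule finite_blocks[OF assms])
  have "(\<Sum>e\<in>E. h e) = (\<Sum>e\<in>blocks E. h e) + (\<Sum>e\<in>prod.swap ` blocks E. h e)"
    by (subst split, subst sum.union_disjoint) (use finb disj in auto)
  also have "(\<Sum>e\<in>prod.swap ` blocks E. h e) = (\<Sum>e\<in>blocks E. h (prod.swap e))"
    by (subst sum.reindex) auto
  also have "(\<Sum>e\<in>blocks E. h e) + (\<Sum>e\<in>blocks E. h (prod.swap e))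
      = (\<Sum>(i, j)\<in>blocks E. h (i, j) + h (j, i))"
    by (simp add: sum.distrib split_beta prod.swap_def)
  finally show ?thesis .
qed

lemma edge_map_add: "edge_map E (\<lambda>e. z e + w e) i = edge_map E z i + edge_map E w i"
  by (simp add: edge_map_def sum.distrib[symmetric] algebra_simps)

lemma edge_map_diff: "edge_map E (\<lambda>e. z e - w e) i = edge_map E z i - edge_map E w i"
  by (simp add: edge_map_def sum_subtractf[symmetric] algebra_simps)

lemma edge_map_sum:
  "edge_map E (\<lambda>e. \<Sum>k\<in>K. z k e) i = (\<Sum>k\<in>K. edge_map E (z k) i)"
  unfolding edge_map_def sum_subtractf[symmetric] by (rule sum.swap)

text \<open>This computes the adjoint of \<open>edge_map\<close>: it sends node vectors
  \<open>a\<close> to the edge differences \<open>a i - a j\<close>.\<close>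

lemma sum_inner_edge_map:
  fixes a :: "nat \<Rightarrow> real ^ 's"
  assumes "connected_graph N E"
  shows "(\<Sum>i = 1..N. a i \<bullet> edge_map E z i) = (\<Sum>(i, j)\<in>E. (a i - a j) \<bullet> z (i, j))"
proof -
  have E: "sym E" "E \<subseteq> {1..N} \<times> {1..N}"
    using assms by (auto simp: connected_graph_def)
  have finj: "finite {j. (i, j) \<in> E}" for i
    by (rule finite_neighbours[OF finite_connected_graph[OF assms]])
  have Sig: "Sigma {1..N} (\<lambda>i. {j. (i, j) \<in> E}) = E"
    using E(2) by auto
  have "(\<Sum>i = 1..N. a i \<bullet> edge_map E z i)
      = (\<Sum>i = 1..N. \<Sum>j\<in>{j. (i, j) \<in> E}. a i \<bullet> (z (i, j) - z (j, i)))"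
    by (simp add: edge_map_def inner_sum_right)
  also have "\<dots> = (\<Sum>(i, j)\<in>E. a i \<bullet> (z (i, j) - z (j, i)))"
    by (subst sum.Sigma) (use finj Sig in auto)
  also have "\<dots> = (\<Sum>(i, j)\<in>E. a i \<bullet> z (i, j)) - (\<Sum>(i, j)\<in>E. a i \<bullet> z (j, i))"
    by (simp add: inner_diff_right split_beta sum_subtractf)
  also have "(\<Sum>(i, j)\<in>E. a i \<bullet> z (j, i)) = (\<Sum>(i, j)\<in>E. a j \<bullet> z (i, j))"
    by (rule sum.reindex_bij_witness[of _ prod.swap prod.swap])
      (use E(1) in \<open>auto simp: sym_def\<close>)
  finally show ?thesis
    by (simp add: inner_diff_left split_beta sum_subtractf)
qed

section \<open>Zero-sum allocations as divergences of flows\<close>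

text \<open>\<open>edge_map\<close> is a divergence, and \<open>v\<close> is sent along a path from
  \<open>a\<close> to \<open>b\<close>. Placing \<open>v\<close> on one further edge
  \<open>(b, c)\<close> cancels the deficit at \<open>b\<close> and moves it to
  \<open>c\<close>.\<close>

lemma edge_map_unit_flow:
  fixes v :: "real ^ 's"
  assumes graph: "connected_graph N E" and e: "(a, b) \<in> E\<^sup>*"
  shows "\<exists>z. \<forall>i. edge_map E z i = (if i = a then v else 0) - (if i = b then v else 0)"
  using e
proof (induction rule: rtrancl_induct)
  case base
  show ?case by (rule exI[of _ "\<lambda>_. 0"]) (simp add: edge_map_def)
next
  case (step b c)
  have E: "sym E" "E \<subseteq> {1..N} \<times> {1..N}" "b \<noteq> c"
    using graph step by (auto simp: connected_graph_def irrefl_def)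
  have finj: "finite {j. (i, j) \<in> E}" for i
    by (rule finite_neighbours[OF finite_connected_graph[OF graph]])
  obtain z where z: "\<And>i. edge_map E z i = (if i = a then v else 0) - (if i = b then v else 0)"
    using step.IH by blast
  define w where "w = (\<lambda>e. if e = (b, c) then v else 0)"
  have "edge_map E w i = (if i = b then v else 0) - (if i = c then v else 0)" for i
  proof -
    have "edge_map E w i = (\<Sum>j\<in>{j. (i, j) \<in> E}. if j = c then (if i = b then v else 0) else 0)
        - (\<Sum>j\<in>{j. (i, j) \<in> E}. if j = b then (if i = c then v else 0) else 0)"
      unfolding edge_map_def w_def sum_subtractf by (intro arg_cong2[where f = minus] sum.cong) auto
    then show ?thesis
      using step.hyps(2) E(1) by (auto simp: finj sym_def)
  qed
  then show ?case
    by (intro exI[of _ "\<lambda>e. z e + w e"]) (simp add: edge_map_add z)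
qed

text \<open>Each \<open>y k\<close> is routed from node \<open>k\<close> to node 1. Superposing the
  flows leaves at node 1 an extra deficit equal to the total, which is zero.\<close>

lemma edge_map_surj_zero_sum:
  fixes y :: "nat \<Rightarrow> real ^ 's"
  assumes graph: "connected_graph N E" and y: "(\<Sum>i = 1..N. y i) = 0" and N: "1 \<le> N"
  obtains z where "\<And>i. i \<in> {1..N} \<Longrightarrow> edge_map E z i = y i"
proof -
  have "\<forall>k\<in>{1..N}. \<exists>z. \<forall>i. edge_map E z i = (if i = k then y k else 0) - (if i = 1 then y k else 0)"
    using graph N by (intro ballI edge_map_unit_flow[OF graph]) (auto simp: connected_graph_def)
  then obtain z where z: "\<And>k i. k \<in> {1..N} \<Longrightarrow>
      edge_map E (z k) i = (if i = k then y k else 0) - (if i = 1 then y k else 0)"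
    by metis
  show thesis
  proof (rule that)
    fix i assume i: "i \<in> {1..N}"
    have "edge_map E (\<lambda>e. \<Sum>k = 1..N. z k e) i
        = (\<Sum>k = 1..N. (if i = k then y k else 0) - (if i = 1 then y k else 0))"
      by (simp add: edge_map_sum z)
    also have "\<dots> = y i - (if i = 1 then (\<Sum>k = 1..N. y k) else 0)"
      using i by (simp add: sum_subtractf)
    finally show "edge_map E (\<lambda>e. \<Sum>k = 1..N. z k e) i = y i"
      using y by simp
  qed
qed

text \<open>A feasible point of the coupled problem induces a zero-sum allocation under which each
  agent is feasible with zero relaxation. This direction of the comparison turns a bound on the gap
  to the edge minimum into one on the gap to the optimal cost.\<close>

lemma min_edge_objective_le_optimal_cost:
  fixes g :: "nat \<Rightarrow> 'a \<Rightarrow> real ^ 's"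
  assumes graph: "connected_graph N E" and N: "1 \<le> N"
    and lower: "\<And>i v a. i \<in> {1..N} \<Longrightarrow> a \<in> feasible_set (local_domain (X i)) (local_constraint (g i) v)
        \<Longrightarrow> local_value (f i) (g i) (X i) M v \<le> local_cost (f i) M a"
    and zstar: "\<And>w. edge_objective N E f g X M zstar \<le> edge_objective N E f g X M w"
    and feasible: "xbar \<in> feasible_set (coupled_domain N X) (coupling_constraint N g)"
  shows "edge_objective N E f g X M zstar
    \<le> optimal_cost (coupled_cost N f) (coupled_domain N X) (coupling_constraint N g)"
  unfolding optimal_cost_def
proof (rule cINF_greatest)
  show "feasible_set (coupled_domain N X) (coupling_constraint N g) \<noteq> {}"
    using feasible by blast
  fix x assume "x \<in> feasible_set (coupled_domain N X) (coupling_constraint N g)"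
  then have x: "\<And>i. i \<in> {1..N} \<Longrightarrow> x i \<in> X i" "(\<Sum>i = 1..N. g i (x i)) \<le> 0"
    by (auto simp: feasible_set_def coupled_domain_def coupling_constraint_def)
  \<comment> \<open>Subtracting the average \<open>r\<close> makes the allocations sum to zero; as
    \<open>r \<le> 0\<close>, each agent only gains slack.\<close>
  define r where "r = (1 / real N) *\<^sub>R (\<Sum>i = 1..N. g i (x i))"
  have r: "r $ k \<le> 0" for k
    using x(2) by (simp add: r_def less_eq_vec_def divide_nonpos_nonneg)
  have "(\<Sum>i = 1..N. g i (x i) - r) = 0"
    unfolding sum_subtractf sum_constant_scaleR r_def using N by simp
  then obtain w where w: "\<And>i. i \<in> {1..N} \<Longrightarrow> edge_map E w i = g i (x i) - r"
    using edge_map_surj_zero_sum[OF graph _ N, of "\<lambda>i. g i (x i) - r"] by blast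
  have "edge_objective N E f g X M zstar \<le> edge_objective N E f g X M w"
    by (rule zstar)
  also have "\<dots> \<le> (\<Sum>i = 1..N. local_cost (f i) M (x i, 0))"
    unfolding edge_objective_def
  proof (intro sum_mono lower)
    fix i assume i: "i \<in> {1..N}"
    show "(x i, 0) \<in> feasible_set (local_domain (X i)) (local_constraint (g i) (edge_map E w i))"
      using x(1)[OF i] r w[OF i]
      by (auto simp: feasible_set_def local_domain_def local_constraint_def less_eq_vec_def)
  qed auto
  also have "\<dots> = coupled_cost N f x"
    by (simp add: local_cost_def coupled_cost_def)
  finally show "edge_objective N E f g X M zstar \<le> coupled_cost N f x" .
qed

text \<open>Chain rule: the adjoint of \<open>edge_map\<close> maps the local subgradients
  \<open>- m i\<close> to the differences \<open>m j - m i\<close>.\<close>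

lemma edge_subgradient_multipliers:
  fixes m :: "nat \<Rightarrow> real ^ 's"
  assumes graph: "connected_graph N E"
    and sub: "\<And>i w. i \<in> {1..N} \<Longrightarrow>
        local_value (f i) (g i) (X i) M (edge_map E z i) - m i \<bullet> (w - edge_map E z i)
          \<le> local_value (f i) (g i) (X i) M w"
  shows "edge_subgradient E (edge_objective N E f g X M) z (\<lambda>(i, j). m j - m i)"
  unfolding edge_subgradient_def
proof
  fix w
  have "(\<Sum>i = 1..N. m i \<bullet> (edge_map E w i - edge_map E z i))
      = (\<Sum>(i, j)\<in>E. (m i - m j) \<bullet> (w (i, j) - z (i, j)))"
    using sum_inner_edge_map[OF graph, of m "\<lambda>e. w e - z e"] by (simp add: edge_map_diff)
  also have "\<dots> = - (\<Sum>e\<in>E. (case e of (i, j) \<Rightarrow> m j - m i) \<bullet> (w e - z e))"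
    unfolding sum_negf[symmetric] by (rule sum.cong) (auto simp: algebra_simps)
  finally have "edge_objective N E f g X M z + (\<Sum>e\<in>E. (case e of (i, j) \<Rightarrow> m j - m i) \<bullet> (w e - z e))
      = (\<Sum>i = 1..N. local_value (f i) (g i) (X i) M (edge_map E z i)
          - m i \<bullet> (edge_map E w i - edge_map E z i))"
    by (simp add: edge_objective_def sum_subtractf)
  also have "\<dots> \<le> edge_objective N E f g X M w"
    unfolding edge_objective_def by (intro sum_mono sub)
  finally show "edge_objective N E f g X M z
      + (\<Sum>e\<in>E. (case e of (i, j) \<Rightarrow> m j - m i) \<bullet> (w e - z e)) \<le> edge_objective N E f g X M w" .
qed

text \<open>The algorithm determines edge variables only on \<open>E\<close>. Symmetry is used
  because \<open>edge_map\<close> also reads the reversed pairs.\<close>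

lemma edge_map_cong:
  assumes "sym E" "\<And>e. e \<in> E \<Longrightarrow> z e = w e"
  shows "edge_map E z i = edge_map E w i"
  unfolding edge_map_def using assms by (intro sum.cong) (auto simp: sym_def)


section \<open>Randomized block subgradient steps\<close>

text \<open>Adaptedness is stated pointwise: samples with equal draws before \<open>t\<close> give
  equal values of \<open>F\<close>. Hence \<open>F\<close> factors through the history
  \<open>K\<close>, which is independent of the draw at \<open>t\<close>, and the expectation of the
  product splits.\<close>

lemma random_activation_indep_past:
  fixes F :: "'w \<Rightarrow> real"
  assumes act: "random_activation P E \<sigma> \<nu>" and fin: "finite (blocks E)"
    and past: "\<And>\<omega> \<omega>'. \<lbrakk>\<omega> \<in> space P; \<omega>' \<in> space P; \<And>s k. \<lbrakk>s < t; k \<in> blocks E\<rbrakk> \<Longrightarrow> \<nu> s k \<omega> = \<nu> s k \<omega>'\<rbrakk>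
        \<Longrightarrow> F \<omega> = F \<omega>'"
  shows random_activation_integrable_past: "integrable P F"
    and random_activation_integrable_active: "\<And>l. l \<in> blocks E \<Longrightarrow> integrable P (\<lambda>\<omega>. of_bool (\<nu> t l \<omega>) * F \<omega>)"
    and random_activation_integral_active:
      "\<And>l. l \<in> blocks E \<Longrightarrow> (LINT \<omega>|P. of_bool (\<nu> t l \<omega>) * F \<omega>) = \<sigma> l * (LINT \<omega>|P. F \<omega>)"
proof -
  interpret prob_space P
    using act by (simp add: random_activation_def)
  define J where "J = {..<t} \<times> blocks E"
  define S where "S = Pi\<^sub>M J (\<lambda>_. count_space (UNIV :: bool set))"
  define S' where "S' = Pi\<^sub>M ({t} \<times> blocks E) (\<lambda>_. count_space (UNIV :: bool set))"
  define K where "K = (\<lambda>\<omega>. \<lambda>(s, l) \<in> J. \<nu> s l \<omega>)"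
  define A where "A = (\<lambda>\<omega>. \<lambda>(s, l) \<in> {t} \<times> blocks E. \<nu> s l \<omega>)"
  have indep: "indep_var S' A S K"
    using act by (simp add: random_activation_def S_def S'_def K_def A_def J_def)
  have finJ: "finite J" using fin by (simp add: J_def)
  have S: "S = count_space (PiE J (\<lambda>_. UNIV))"
    unfolding S_def by (rule count_space_PiM_finite) (use finJ in auto)
  \<comment> \<open>The past is a random variable with values in a finite discrete space, so every function of
    it is measurable and bounded, whatever the multiplier selection is.\<close>
  define \<phi> where "\<phi> h = F (SOME \<omega>. \<omega> \<in> space P \<and> K \<omega> = h)" for h
  \<comment> \<open>By \<open>past\<close>, \<open>F\<close> is constant on each history, so the
    chosen representative does not matter; histories that no sample realizes receive an arbitrary
    value.\<close>
  have F: "F \<omega> = \<phi> (K \<omega>)" if \<omega>: "\<omega> \<in> space P" for \<omega>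
  proof -
    let ?\<omega> = "SOME \<omega>'. \<omega>' \<in> space P \<and> K \<omega>' = K \<omega>"
    have "?\<omega> \<in> space P \<and> K ?\<omega> = K \<omega>"
      by (rule someI[of _ \<omega>]) (use \<omega> in simp)
    then have \<omega>': "?\<omega> \<in> space P" "K ?\<omega> = K \<omega>" by blast+
    have "\<nu> s k \<omega> = \<nu> s k ?\<omega>" if "s < t" "k \<in> blocks E" for s k
      using fun_cong[OF \<omega>'(2), of "(s, k)"] that by (simp add: K_def J_def)
    then show ?thesis
      unfolding \<phi>_def using \<omega> \<omega>'(1) by (intro past)
  qed
  have \<phi>: "\<phi> \<in> borel_measurable S" by (simp add: S)
  have K: "K \<in> measurable P S" using indep by (rule indep_var_rv2)
  have Kmem: "K \<omega> \<in> PiE J (\<lambda>_. UNIV)" for \<omega>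
    by (simp add: K_def)
  have int\<phi>: "integrable P (\<lambda>\<omega>. \<phi> (K \<omega>))"
  proof (rule integrable_const_bound)
    show "(\<lambda>\<omega>. \<phi> (K \<omega>)) \<in> borel_measurable P"
      using measurable_compose[OF K \<phi>] .
    have "finite (PiE J (\<lambda>_. UNIV :: bool set))"
      using finJ by (intro finite_PiE) auto
    then show "AE \<omega> in P. norm (\<phi> (K \<omega>)) \<le> Max ((\<lambda>h. norm (\<phi> h)) ` PiE J (\<lambda>_. UNIV))"
      using Kmem by (intro AE_I2 Max_ge) auto
  qed
  show "integrable P F"
    using int\<phi> by (subst Bochner_Integration.integrable_cong[OF refl F])
  fix l assume l: "l \<in> blocks E"
  have active: "\<nu> t l \<in> measurable P (count_space UNIV)"
    and distr: "distr P (count_space UNIV) (\<nu> t l) = measure_pmf (bernoulli_pmf (\<sigma> l))"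
    and \<sigma>: "0 \<le> \<sigma> l" "\<sigma> l \<le> 1"
    using act l by (auto simp: random_activation_def blocks_def)
  have int\<nu>: "integrable P (\<lambda>\<omega>. of_bool (\<nu> t l \<omega>) :: real)"
    by (rule integrable_const_bound[where B = 1]) (use active in auto)
  have exp\<nu>: "(LINT \<omega>|P. of_bool (\<nu> t l \<omega>)) = \<sigma> l"
  proof -
    have "(LINT \<omega>|P. of_bool (\<nu> t l \<omega>) :: real) = (LINT b|measure_pmf (bernoulli_pmf (\<sigma> l)). of_bool b)"
      unfolding distr[symmetric] using active by (subst integral_distr) auto
    also have "\<dots> = \<sigma> l"
      using \<sigma> by simp
    finally show ?thesis .
  qed
  have "indep_var borel ((\<lambda>h. of_bool (h (t, l)) :: real) \<circ> A) borel (\<phi> \<circ> K)"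
  proof (rule indep_var_compose[OF indep _ \<phi>])
    have "(\<lambda>h. h (t, l)) \<in> measurable S' (count_space UNIV)"
      unfolding S'_def by (rule measurable_component_singleton) (use l in auto)
    then show "(\<lambda>h. of_bool (h (t, l)) :: real) \<in> borel_measurable S'"
      by (rule measurable_compose) simp
  qed
  then have indep': "indep_var borel (\<lambda>\<omega>. of_bool (\<nu> t l \<omega>) :: real) borel (\<lambda>\<omega>. \<phi> (K \<omega>))"
    using l by (simp add: A_def comp_def)
  have eq: "of_bool (\<nu> t l \<omega>) * F \<omega> = of_bool (\<nu> t l \<omega>) * \<phi> (K \<omega>)" if "\<omega> \<in> space P" for \<omega>
    using F[OF that] by simp
  show "integrable P (\<lambda>\<omega>. of_bool (\<nu> t l \<omega>) * F \<omega>)"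
    using indep_var_integrable[OF indep' int\<nu> int\<phi>] by (subst Bochner_Integration.integrable_cong[OF refl eq])
  have "(LINT \<omega>|P. of_bool (\<nu> t l \<omega>) * F \<omega>) = (LINT \<omega>|P. of_bool (\<nu> t l \<omega>) * \<phi> (K \<omega>))"
    by (rule Bochner_Integration.integral_cong[OF refl eq])
  also have "\<dots> = \<sigma> l * (LINT \<omega>|P. \<phi> (K \<omega>))"
    using indep_var_lebesgue_integral[OF indep' int\<nu> int\<phi>] exp\<nu> by simp
  also have "(LINT \<omega>|P. \<phi> (K \<omega>)) = (LINT \<omega>|P. F \<omega>)"
    by (rule Bochner_Integration.integral_cong) (use F in auto)
  finally show "(LINT \<omega>|P. of_bool (\<nu> t l \<omega>) * F \<omega>) = \<sigma> l * (LINT \<omega>|P. F \<omega>)" .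
qed

section \<open>Expected descent of the block iterates\<close>

lemma inner_block: "block d l \<bullet> block w l = (case l of (i, j) \<Rightarrow> d (i, j) \<bullet> w (i, j) + d (j, i) \<bullet> w (j, i))"
  by (simp add: block_def inner_prod_def split_beta)

text \<open>Expansion of the square. The indicator is kept as a factor so that the draw can later be
  separated from a bracket determined by the past.\<close>

lemma norm_block_update_sq:
  assumes "\<And>e. e \<in> {(i, j), (j, i)} \<Longrightarrow> z' e = (if b then z e - \<alpha> *\<^sub>R d e else z e)"
  shows "(norm (block (\<lambda>e. z' e - w e) (i, j)))\<^sup>2 = (norm (block (\<lambda>e. z e - w e) (i, j)))\<^sup>2
    + of_bool b * (\<alpha>\<^sup>2 * (norm (block d (i, j)))\<^sup>2
        - 2 * \<alpha> * (block d (i, j) \<bullet> block (\<lambda>e. z e - w e) (i, j)))"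
  unfolding power2_norm_eq_inner inner_block using assms
  by (simp add: algebra_simps power2_eq_square inner_commute)

text \<open>The direction \<open>D\<close> is deterministic, so the iterate at time \<open>s\<close>
  is a function of the draws before \<open>s\<close>. This provides the pointwise adaptedness
  required of \<open>F\<close> above.\<close>

lemma random_block_iterate_past:
  assumes graph: "connected_graph N E"
    and D_cong: "\<And>v w. (\<And>e. e \<in> E \<Longrightarrow> v e = w e) \<Longrightarrow> D v = D w"
    and init: "\<And>\<omega> e. \<lbrakk>\<omega> \<in> \<Omega>; e \<in> E\<rbrakk> \<Longrightarrow> z 0 \<omega> e = z0 e"
    and upd: "\<And>\<omega> s e. \<lbrakk>\<omega> \<in> \<Omega>; e \<in> E\<rbrakk> \<Longrightarrow> z (Suc s) \<omega> e =
        (if e \<in> active_edges E \<nu> s \<omega> then z s \<omega> e - \<alpha> *\<^sub>R D (z s \<omega>) e else z s \<omega> e)"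
    and \<omega>: "\<omega> \<in> \<Omega>" "\<omega>' \<in> \<Omega>"
    and past: "\<And>r k. \<lbrakk>r < s; k \<in> blocks E\<rbrakk> \<Longrightarrow> \<nu> r k \<omega> = \<nu> r k \<omega>'"
  shows "\<forall>e\<in>E. z s \<omega> e = z s \<omega>' e"
  using past
proof (induction s)
  case 0
  then show ?case using init \<omega> by simp
next
  case (Suc s)
  then have IH: "\<forall>e\<in>E. z s \<omega> e = z s \<omega>' e" by simp
  then have "D (z s \<omega>) = D (z s \<omega>')" by (intro D_cong) auto
  moreover have "e \<in> active_edges E \<nu> s \<omega> \<longleftrightarrow> e \<in> active_edges E \<nu> s \<omega>'" if "e \<in> E" for e
  proof (cases e)
    case (Pair i j)
    then have "i \<noteq> j" using that graph by (auto simp: connected_graph_def irrefl_def)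
    \<comment> \<open>Both orientations of an edge are governed by the draw of one block.\<close>
    then have "(min i j, max i j) \<in> blocks E"
      using that Pair graph by (auto simp: connected_graph_def blocks_def sym_def min_def max_def)
    then show ?thesis using Suc.prems[of s] Pair by (simp add: active_edges_def)
  qed
  ultimately show ?case using IH upd \<omega> by simp
qed

text \<open>In expectation the factor \<open>\<sigma> l\<close> from activation cancels the weight
  of block \<open>l\<close>, leaving the increment of a full subgradient step. Telescoping over
  \<open>t + 1\<close> steps and dropping the final distance gives the bound.\<close>

lemma random_block_subgradient_bound:
  fixes z0 zs :: "nat \<times> nat \<Rightarrow> real ^ 's"
  assumes graph: "connected_graph N E" and act: "random_activation P E \<sigma> \<nu>"
    and sub: "\<And>w. edge_subgradient E h w (D w)"
    and h_cong: "\<And>v w. (\<And>e. e \<in> E \<Longrightarrow> v e = w e) \<Longrightarrow> h v = h w"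
    and D_cong: "\<And>v w. (\<And>e. e \<in> E \<Longrightarrow> v e = w e) \<Longrightarrow> D v = D w"
    and c: "block_bounds E h c"
    and init: "\<And>\<omega> e. \<lbrakk>\<omega> \<in> space P; e \<in> E\<rbrakk> \<Longrightarrow> z 0 \<omega> e = z0 e"
    and upd: "\<And>\<omega> s e. \<lbrakk>\<omega> \<in> space P; e \<in> E\<rbrakk> \<Longrightarrow> z (Suc s) \<omega> e =
        (if e \<in> active_edges E \<nu> s \<omega> then z s \<omega> e - \<alpha> *\<^sub>R D (z s \<omega>) e else z s \<omega> e)"
    and \<alpha>: "0 < \<alpha>"
    and b: "\<And>s. s \<le> t \<Longrightarrow> b \<le> (LINT \<omega>|P. h (z s \<omega>))"
  shows "b - h zs \<le> weighted_norm_sq E \<sigma> (\<lambda>e. z0 e - zs e) / (2 * \<alpha> * (real t + 1))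
    + (\<Sum>l\<in>blocks E. (c l)\<^sup>2 / \<sigma> l) * \<alpha> / 2"
proof -
  interpret prob_space P
    using act by (simp add: random_activation_def)
  have symE: "sym E" using graph by (simp add: connected_graph_def)
  have finb: "finite (blocks E)" by (rule finite_blocks[OF graph])
  have \<sigma>: "0 < \<sigma> l" "\<sigma> l \<le> 1" if "l \<in> blocks E" for l
    using act that by (auto simp: random_activation_def blocks_def)
  define W where "W s \<omega> = weighted_norm_sq E \<sigma> (\<lambda>e. z s \<omega> e - zs e)" for s \<omega>
  \<comment> \<open>\<open>H s l\<close> is the change of the squared distance in block
    \<open>l\<close> if that block is active at time \<open>s\<close>.\<close>
  define H where "H s l \<omega> = \<alpha>\<^sup>2 * (norm (block (D (z s \<omega>)) l))\<^sup>2
      - 2 * \<alpha> * (block (D (z s \<omega>)) l \<bullet> block (\<lambda>e. z s \<omega> e - zs e) l)" for s l \<omega>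
  define C where "C = (\<Sum>l\<in>blocks E. (c l)\<^sup>2 / \<sigma> l)"

  have h_past: "h (z s \<omega>) = h (z s \<omega>')"
    and W_past: "W s \<omega> = W s \<omega>'" and H_past: "l \<in> blocks E \<Longrightarrow> H s l \<omega> = H s l \<omega>'"
    if "\<omega> \<in> space P" "\<omega>' \<in> space P" "\<And>r k. \<lbrakk>r < s; k \<in> blocks E\<rbrakk> \<Longrightarrow> \<nu> r k \<omega> = \<nu> r k \<omega>'" for s l \<omega> \<omega>'
  proof -
    have eq: "\<And>e. e \<in> E \<Longrightarrow> z s \<omega> e = z s \<omega>' e"
      using random_block_iterate_past[where D = D, OF graph D_cong init upd that] by blast
    have block_eq: "block (\<lambda>e. z s \<omega> e - zs e) l = block (\<lambda>e. z s \<omega>' e - zs e) l"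
      if "l \<in> blocks E" for l
      using that symE eq by (auto simp: block_def blocks_def sym_def)
    show "h (z s \<omega>) = h (z s \<omega>')" by (intro h_cong eq)
    show "W s \<omega> = W s \<omega>'"
      unfolding W_def weighted_norm_sq_def by (intro sum.cong refl) (simp add: block_eq)
    show "H s l \<omega> = H s l \<omega>'" if "l \<in> blocks E"
    proof -
      have "D (z s \<omega>) = D (z s \<omega>')" by (intro D_cong eq)
      then show ?thesis unfolding H_def block_eq[OF that] by simp
    qed
  qed
  have int_h: "integrable P (\<lambda>\<omega>. h (z s \<omega>))" for s
    by (rule random_activation_integrable_past[OF act finb]) (rule h_past; blast)
  have int_W: "integrable P (W s)" for s
    by (rule random_activation_integrable_past[OF act finb]) (rule W_past; blast)

  have descent: "(\<Sum>l\<in>blocks E. H s l \<omega>) \<le> \<alpha>\<^sup>2 * C - 2 * \<alpha> * (h (z s \<omega>) - h zs)" for s \<omega>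
  proof -
    let ?d = "D (z s \<omega>)" and ?w = "\<lambda>e. z s \<omega> e - zs e"
    have "(\<Sum>l\<in>blocks E. (norm (block ?d l))\<^sup>2) \<le> C"
      unfolding C_def
    proof (rule sum_mono)
      fix l assume l: "l \<in> blocks E"
      have "norm (block ?d l) \<le> c l"
        using c l sub by (auto simp: block_bounds_def)
      then have "(norm (block ?d l))\<^sup>2 \<le> (c l)\<^sup>2"
        by (simp add: power_mono)
      \<comment> \<open>Since \<open>\<sigma> l \<le> 1\<close>, the unweighted sum of squares is at
        most the weighted constant \<open>C\<close>.\<close>
      also have "\<dots> \<le> (c l)\<^sup>2 / \<sigma> l"
        using \<sigma>[OF l] by (simp add: pos_le_divide_eq mult_left_le)
      finally show "(norm (block ?d l))\<^sup>2 \<le> (c l)\<^sup>2 / \<sigma> l" .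
    qed
    then have "\<alpha>\<^sup>2 * (\<Sum>l\<in>blocks E. (norm (block ?d l))\<^sup>2) \<le> \<alpha>\<^sup>2 * C"
      by (simp add: mult_left_mono)
    moreover have "h (z s \<omega>) - h zs \<le> (\<Sum>l\<in>blocks E. block ?d l \<bullet> block ?w l)"
    proof -
      have "(\<Sum>l\<in>blocks E. block ?d l \<bullet> block ?w l) = (\<Sum>e\<in>E. ?d e \<bullet> ?w e)"
        unfolding inner_block by (rule sum_edges_eq_sum_blocks[OF graph, symmetric])
      also have "\<dots> = - (\<Sum>e\<in>E. ?d e \<bullet> (zs e - z s \<omega> e))"
        by (simp add: sum_negf[symmetric] inner_diff_right)
      finally have "(\<Sum>l\<in>blocks E. block ?d l \<bullet> block ?w l) = - (\<Sum>e\<in>E. ?d e \<bullet> (zs e - z s \<omega> e))" .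
      moreover have "h (z s \<omega>) + (\<Sum>e\<in>E. ?d e \<bullet> (zs e - z s \<omega> e)) \<le> h zs"
        using sub[of "z s \<omega>"] unfolding edge_subgradient_def by blast
      ultimately show ?thesis by linarith
    qed
    then have "2 * \<alpha> * (h (z s \<omega>) - h zs) \<le> 2 * \<alpha> * (\<Sum>l\<in>blocks E. block ?d l \<bullet> block ?w l)"
      using \<alpha> by simp
    ultimately show ?thesis
      unfolding H_def sum_subtractf sum_distrib_left[symmetric] by linarith
  qed

  have W_Suc: "W (Suc s) \<omega> = W s \<omega> + (\<Sum>l\<in>blocks E. of_bool (\<nu> s l \<omega>) * H s l \<omega> / \<sigma> l)"
    if \<omega>: "\<omega> \<in> space P" for s \<omega>
    unfolding W_def weighted_norm_sq_def sum.distrib[symmetric]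
  proof (rule sum.cong[OF refl])
    fix l assume l: "l \<in> blocks E"
    obtain i j where ij: "l = (i, j)" by (cases l)
    have "i < j" "(i, j) \<in> E" "(j, i) \<in> E"
      using l ij symE by (auto simp: blocks_def sym_def)
    then have "z (Suc s) \<omega> e = (if \<nu> s l \<omega> then z s \<omega> e - \<alpha> *\<^sub>R D (z s \<omega>) e else z s \<omega> e)"
      if "e \<in> {(i, j), (j, i)}" for e
      using upd[OF \<omega>] that ij by (auto simp: active_edges_def)
    from norm_block_update_sq[where w = zs, OF this]
    show "(norm (block (\<lambda>e. z (Suc s) \<omega> e - zs e) l))\<^sup>2 / \<sigma> l =
        (norm (block (\<lambda>e. z s \<omega> e - zs e) l))\<^sup>2 / \<sigma> l + of_bool (\<nu> s l \<omega>) * H s l \<omega> / \<sigma> l"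
      by (simp add: ij H_def add_divide_distrib)
  qed

  have step: "(LINT \<omega>|P. W (Suc s) \<omega>)
      \<le> (LINT \<omega>|P. W s \<omega>) + \<alpha>\<^sup>2 * C - 2 * \<alpha> * ((LINT \<omega>|P. h (z s \<omega>)) - h zs)" for s
  proof -
    have int_H: "integrable P (\<lambda>\<omega>. H s l \<omega>)"
      if "l \<in> blocks E" for l
      by (rule random_activation_integrable_past[OF act finb])
        (rule H_past; use that in blast)
    have int_active: "integrable P (\<lambda>\<omega>. of_bool (\<nu> s l \<omega>) * H s l \<omega>)"
      if "l \<in> blocks E" for l
      by (rule random_activation_integrable_active[OF act finb _ that])
        (rule H_past; use that in blast)
    have exp_active: "(LINT \<omega>|P. of_bool (\<nu> s l \<omega>) * H s l \<omega>) = \<sigma> l * (LINT \<omega>|P. H s l \<omega>)"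
      if "l \<in> blocks E" for l
      by (rule random_activation_integral_active[OF act finb _ that])
        (rule H_past; use that in blast)
    have "(LINT \<omega>|P. W (Suc s) \<omega>)
        = (LINT \<omega>|P. W s \<omega> + (\<Sum>l\<in>blocks E. of_bool (\<nu> s l \<omega>) * H s l \<omega> / \<sigma> l))"
      by (rule Bochner_Integration.integral_cong[OF refl W_Suc])
    also have "\<dots> = (LINT \<omega>|P. W s \<omega>)
        + (\<Sum>l\<in>blocks E. (LINT \<omega>|P. of_bool (\<nu> s l \<omega>) * H s l \<omega>) / \<sigma> l)"
      using int_W int_active by (simp add: Bochner_Integration.integral_sum)
    also have "(\<Sum>l\<in>blocks E. (LINT \<omega>|P. of_bool (\<nu> s l \<omega>) * H s l \<omega>) / \<sigma> l)
        = (\<Sum>l\<in>blocks E. (LINT \<omega>|P. H s l \<omega>))"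
      using exp_active \<sigma> by (intro sum.cong refl) (simp add: less_imp_neq[THEN not_sym])
    also have "\<dots> = (LINT \<omega>|P. (\<Sum>l\<in>blocks E. H s l \<omega>))"
      using int_H by (simp add: Bochner_Integration.integral_sum)
    also have "\<dots> \<le> (LINT \<omega>|P. \<alpha>\<^sup>2 * C - 2 * \<alpha> * (h (z s \<omega>) - h zs))"
      using int_H int_h descent by (intro integral_mono) auto
    also have "\<dots> = \<alpha>\<^sup>2 * C - 2 * \<alpha> * ((LINT \<omega>|P. h (z s \<omega>)) - h zs)"
      using int_h by (simp add: prob_space)
    finally show ?thesis by simp
  qed
  \<comment> \<open>The sum covers times 0 to \<open>s - 1\<close>, so the instance
    \<open>Suc t\<close> below covers exactly the times up to \<open>t\<close>.\<close>
  have telescope: "(LINT \<omega>|P. W s \<omega>) + 2 * \<alpha> * (\<Sum>r<s. (LINT \<omega>|P. h (z r \<omega>)) - h zs)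
      \<le> weighted_norm_sq E \<sigma> (\<lambda>e. z0 e - zs e) + real s * \<alpha>\<^sup>2 * C" for s
  proof (induction s)
    case 0
    have "W 0 \<omega> = weighted_norm_sq E \<sigma> (\<lambda>e. z0 e - zs e)" if "\<omega> \<in> space P" for \<omega>
      unfolding W_def weighted_norm_sq_def using init[OF that] symE
      by (intro sum.cong) (auto simp: block_def blocks_def sym_def)
    then have "(LINT \<omega>|P. W 0 \<omega>) = (LINT \<omega>|P. weighted_norm_sq E \<sigma> (\<lambda>e. z0 e - zs e))"
      by (rule Bochner_Integration.integral_cong[OF refl])
    then show ?case by (simp add: prob_space)
  next
    case (Suc s)
    then show ?case using step[of s] by (simp add: algebra_simps)
  qed
  have "0 \<le> (LINT \<omega>|P. W (Suc t) \<omega>)"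
    unfolding W_def weighted_norm_sq_def using \<sigma>
    by (intro integral_nonneg_AE AE_I2 sum_nonneg divide_nonneg_pos) auto
  moreover have "(real t + 1) * (b - h zs) \<le> (\<Sum>r<Suc t. (LINT \<omega>|P. h (z r \<omega>)) - h zs)"
    using sum_bounded_below[of "{..<Suc t}" "b - h zs" "\<lambda>r. (LINT \<omega>|P. h (z r \<omega>)) - h zs"] b
    by (simp add: add.commute)
  then have "2 * \<alpha> * ((real t + 1) * (b - h zs))
      \<le> 2 * \<alpha> * (\<Sum>r<Suc t. (LINT \<omega>|P. h (z r \<omega>)) - h zs)"
    using \<alpha> by (intro mult_left_mono) auto
  ultimately have "(b - h zs) * (2 * \<alpha> * (real t + 1))
      \<le> weighted_norm_sq E \<sigma> (\<lambda>e. z0 e - zs e) + (real t + 1) * \<alpha>\<^sup>2 * C"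
    using telescope[of "Suc t"] by (simp add: algebra_simps)
  then have "b - h zs \<le> (weighted_norm_sq E \<sigma> (\<lambda>e. z0 e - zs e) + (real t + 1) * \<alpha>\<^sup>2 * C)
      / (2 * \<alpha> * (real t + 1))"
    using \<alpha> by (simp add: pos_le_divide_eq)
  also have "\<dots> = weighted_norm_sq E \<sigma> (\<lambda>e. z0 e - zs e) / (2 * \<alpha> * (real t + 1)) + C * \<alpha> / 2"
  proof -
    have "(w + u * \<alpha>\<^sup>2 * C) / (2 * \<alpha> * u) = w / (2 * \<alpha> * u) + C * \<alpha> / 2" if "0 < u" for w u
      using \<alpha> that by (simp add: add_divide_distrib power2_eq_square)
    from this[of "real t + 1"] show ?thesis by simp
  qed
  finally show ?thesis by (simp add: C_def)
qed


section \<open>Convergence bound\<close>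

theorem propositionV2:
  fixes N :: nat
    and n :: "nat \<Rightarrow> nat"
    and V X :: "nat \<Rightarrow> ('a :: euclidean_space) set"  (* V i plays the role of R^(n i) *)
    and f :: "nat \<Rightarrow> 'a \<Rightarrow> real"
    and g :: "nat \<Rightarrow> 'a \<Rightarrow> real ^ 's"
    and xbar :: "nat \<Rightarrow> 'a"
    and fstar M \<alpha> C :: real
    and mustar :: "real ^ 's"
    and E :: "(nat \<times> nat) set"
    and P :: "'w measure"
    and \<sigma> c :: "nat \<times> nat \<Rightarrow> real"
    and \<nu> :: "nat \<Rightarrow> nat \<times> nat \<Rightarrow> 'w \<Rightarrow> bool"
    and step :: "nat \<Rightarrow> real"
    and z0 zstar :: "nat \<times> nat \<Rightarrow> real ^ 's"
    and y0 :: "nat \<Rightarrow> real ^ 's"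
    and z :: "nat \<Rightarrow> 'w \<Rightarrow> nat \<times> nat \<Rightarrow> real ^ 's"
    and y :: "nat \<Rightarrow> 'w \<Rightarrow> nat \<Rightarrow> real ^ 's"
    and x :: "nat \<Rightarrow> 'w \<Rightarrow> nat \<Rightarrow> 'a"
    and \<rho> :: "nat \<Rightarrow> 'w \<Rightarrow> nat \<Rightarrow> real"
    and \<mu> :: "nat \<Rightarrow> 'w \<Rightarrow> nat \<Rightarrow> real ^ 's"
    and t :: nat
  assumes "1 \<le> N"
    and space: "\<And>i. i \<in> {1..N} \<Longrightarrow> subspace (V i) \<and> dim (V i) = n i"
    and X: "\<And>i. i \<in> {1..N} \<Longrightarrow> X i \<subseteq> V i \<and> X i \<noteq> {} \<and> convex (X i) \<and> compact (X i)"
    and f: "\<And>i. i \<in> {1..N} \<Longrightarrow> convex_on (V i) (f i)"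
    and g: "\<And>i k. i \<in> {1..N} \<Longrightarrow> convex_on (V i) (\<lambda>v. g i v $ k)"
    and slater_mem: "\<And>i. i \<in> {1..N} \<Longrightarrow> xbar i \<in> X i"
    and slater: "\<And>k. (\<Sum>i = 1..N. g i (xbar i)) $ k < 0"
    and fstar: "fstar = optimal_cost (coupled_cost N f) (coupled_domain N X) (coupling_constraint N g)"
    and mustar: "optimal_multiplier (coupled_cost N f) (coupled_domain N X) (coupling_constraint N g) mustar"
    and M: "(\<Sum>k\<in>UNIV. \<bar>mustar $ k\<bar>) < M"
    and graph: "connected_graph N E"
    and activation: "random_activation P E \<sigma> \<nu>"
    and z0: "\<And>i. i \<in> {1..N} \<Longrightarrow> edge_map E z0 i = y0 i"
    and y0: "(\<Sum>i = 1..N. y0 i) = 0"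
    and algorithm: "dpd_tv (space P) N E f g X M step \<nu> z0 z y x \<rho> \<mu>"
    and step: "\<And>s. step s = \<alpha>" "0 < \<alpha>"
    and zstar: "\<And>w. edge_objective N E f g X M zstar \<le> edge_objective N E f g X M w"
    and c: "block_bounds E (edge_objective N E f g X M) c"
    and C: "C = (\<Sum>l\<in>blocks E. (c l)\<^sup>2 / \<sigma> l)"
  shows "best_cost P N f M x \<rho> t - fstar
    \<le> weighted_norm_sq E \<sigma> (\<lambda>e. z0 e - zstar e) / (2 * \<alpha> * (real t + 1)) + C * \<alpha> / 2"
proof -
  interpret prob_space P
    using activation by (simp add: random_activation_def)
  have symE: "sym E" and EN: "E \<subseteq> {1..N} \<times> {1..N}"
    using graph by (auto simp: connected_graph_def)
  have finb: "finite (blocks E)" by (rule finite_blocks[OF graph])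
  have fX: "convex_on (X i) (f i)" and gX: "\<And>k. convex_on (X i) (\<lambda>v. g i v $ k)" and ne: "X i \<noteq> {}"
    if "i \<in> {1..N}" for i
    using X[OF that] f[OF that] g[OF that] by (auto intro: convex_on_subset)
  let ?h = "edge_objective N E f g X M"
  obtain m where mult: "\<And>i v. i \<in> {1..N} \<Longrightarrow> optimal_multiplier
          (local_cost (f i) M) (local_domain (X i)) (local_constraint (g i) v) (m i v)"
    and init: "\<And>\<omega> e. \<lbrakk>\<omega> \<in> space P; e \<in> E\<rbrakk> \<Longrightarrow> z 0 \<omega> e = z0 e"
    and yz: "\<And>\<omega> s i. \<lbrakk>\<omega> \<in> space P; i \<in> {1..N}\<rbrakk> \<Longrightarrow> y s \<omega> i = edge_map E (z s \<omega>) i"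
    and opt: "\<And>\<omega> s i. \<lbrakk>\<omega> \<in> space P; i \<in> {1..N}\<rbrakk> \<Longrightarrow> optimal_solution
          (local_cost (f i) M) (local_domain (X i)) (local_constraint (g i) (y s \<omega> i))
          (x s \<omega> i, \<rho> s \<omega> i)"
    and \<mu>: "\<And>\<omega> s i. \<lbrakk>\<omega> \<in> space P; i \<in> {1..N}\<rbrakk> \<Longrightarrow> \<mu> s \<omega> i = m i (y s \<omega> i)"
    and upd: "\<And>\<omega> s i j. \<lbrakk>\<omega> \<in> space P; (i, j) \<in> E\<rbrakk> \<Longrightarrow> z (Suc s) \<omega> (i, j) =
          (if (i, j) \<in> active_edges E \<nu> s \<omega>
           then z s \<omega> (i, j) + step s *\<^sub>R (\<mu> s \<omega> i - \<mu> s \<omega> j) else z s \<omega> (i, j))"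
    using algorithm unfolding dpd_tv_def by fast
  \<comment> \<open>One sample suffices: the optimal solutions along it certify that the local
    problems are bounded below.\<close>
  obtain \<omega>0 where \<omega>0: "\<omega>0 \<in> space P" using not_empty by blast
  note lower = local_value_lower[OF fX gX ne mult opt[OF \<omega>0]]
    and subgradient = local_value_subgradient[OF fX gX ne mult opt[OF \<omega>0]]
  \<comment> \<open>Because the selection \<open>m\<close> is fixed, this direction is a
    deterministic function of the edge variable; its negative is the multiplier difference in the
    update.\<close>
  define D where "D w = (\<lambda>(i, j). m j (edge_map E w j) - m i (edge_map E w i))" for w
  \<comment> \<open>The pairs \<open>(x, \<rho>)\<close> are arbitrary optimal solutions, with no
    measurability in the sample assumed. Their cost equals the local value, which depends on the
    iterate alone.\<close>
  have cost: "f i (x s \<omega> i) + M * \<rho> s \<omega> i = local_value (f i) (g i) (X i) M (edge_map E (z s \<omega>) i)"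
    if "\<omega> \<in> space P" "i \<in> {1..N}" for s \<omega> i
    using local_value_eq_optimal_solution[OF opt[OF that, of s]] yz[OF that]
    by (simp add: local_cost_def)
  have D_cong: "D v = D w" if "\<And>e. e \<in> E \<Longrightarrow> v e = w e" for v w
  proof -
    have "edge_map E v = edge_map E w" by (intro ext edge_map_cong symE that)
    then show ?thesis by (simp add: D_def)
  qed
  have upd_D: "z (Suc s) \<omega> e =
      (if e \<in> active_edges E \<nu> s \<omega> then z s \<omega> e - \<alpha> *\<^sub>R D (z s \<omega>) e else z s \<omega> e)"
    if \<omega>: "\<omega> \<in> space P" and e: "e \<in> E" for \<omega> s e
  proof -
    obtain i j where ij: "e = (i, j)" by (cases e)
    have "i \<in> {1..N}" "j \<in> {1..N}" using e ij EN by auto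
    then have "D (z s \<omega>) e = \<mu> s \<omega> j - \<mu> s \<omega> i"
      by (simp add: D_def ij \<mu>[OF \<omega>] yz[OF \<omega>])
    then show ?thesis
      using upd[OF \<omega>, of i j s] e ij by (simp add: step(1) scaleR_diff_right)
  qed
  \<comment> \<open>\<open>best_cost\<close> sums the agents' expectations; integrability per agent
    allows merging them into the expectation of the edge objective.\<close>
  have integrable_value: "integrable P (\<lambda>\<omega>. local_value (f i) (g i) (X i) M (edge_map E (z s \<omega>) i))" for s i
  proof (rule random_activation_integrable_past[OF activation finb])
    fix \<omega> \<omega>'
    assume past: "\<omega> \<in> space P" "\<omega>' \<in> space P" "\<And>r k. \<lbrakk>r < s; k \<in> blocks E\<rbrakk> \<Longrightarrow> \<nu> r k \<omega> = \<nu> r k \<omega>'"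
    have "z s \<omega> e = z s \<omega>' e" if "e \<in> E" for e
      using random_block_iterate_past[where D = D, OF graph D_cong init upd_D past] that by blast
    then have "edge_map E (z s \<omega>) i = edge_map E (z s \<omega>') i"
      by (rule edge_map_cong[OF symE])
    then show "local_value (f i) (g i) (X i) M (edge_map E (z s \<omega>) i)
        = local_value (f i) (g i) (X i) M (edge_map E (z s \<omega>') i)"
      by simp
  qed
  define b where "b = best_cost P N f M x \<rho> t"

  have "b - ?h zstar \<le> weighted_norm_sq E \<sigma> (\<lambda>e. z0 e - zstar e) / (2 * \<alpha> * (real t + 1))
    + (\<Sum>l\<in>blocks E. (c l)\<^sup>2 / \<sigma> l) * \<alpha> / 2"
  proof (rule random_block_subgradient_bound[OF graph activation _ _ D_cong c init upd_D step(2)])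
    show "edge_subgradient E ?h w (D w)" for w
      unfolding D_def by (rule edge_subgradient_multipliers[OF graph subgradient])
    show "?h v = ?h w" if "\<And>e. e \<in> E \<Longrightarrow> v e = w e" for v w
    proof -
      have "edge_map E v = edge_map E w" by (intro ext edge_map_cong symE that)
      then show ?thesis by (simp add: edge_objective_def)
    qed
    show "b \<le> (LINT \<omega>|P. ?h (z s \<omega>))" if "s \<le> t" for s
    proof -
      have "b \<le> (\<Sum>i = 1..N. LINT \<omega>|P. f i (x s \<omega> i) + M * \<rho> s \<omega> i)"
        unfolding b_def best_cost_def using that by (intro Min_le) auto
      also have "\<dots> = (\<Sum>i = 1..N. LINT \<omega>|P. local_value (f i) (g i) (X i) M (edge_map E (z s \<omega>) i))"
        by (intro sum.cong Bochner_Integration.integral_cong refl cost)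
      also have "\<dots> = (LINT \<omega>|P. ?h (z s \<omega>))"
        unfolding edge_objective_def
        by (rule Bochner_Integration.integral_sum[symmetric]) (rule integrable_value)
      finally show ?thesis .
    qed
  qed auto
  moreover have "?h zstar \<le> fstar"
    unfolding fstar
  proof (rule min_edge_objective_le_optimal_cost[OF graph \<open>1 \<le> N\<close> lower zstar])
    show "xbar \<in> feasible_set (coupled_domain N X) (coupling_constraint N g)"
      using slater_mem slater
      by (simp add: feasible_set_def coupled_domain_def coupling_constraint_def less_eq_vec_def less_imp_le)
  qed
  ultimately show ?thesis
    by (simp add: b_def C)
qed

end
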